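(* Let $K$ be a field and let $\mathcal{I}=\{I_m\}_{m\geq1}$ be a graded family of nonzero monomial ideals of $K[x_1,\ldots,x_n]$. Then the asymptotic initial degree $\alpha(\mathcal{I})$ is the solution (optimal value) of the optimization problem: minimize $y_1+\cdots+y_n$ subject to $(y_1,\ldots,y_n)\in\overline{\mathcal{C}(\mathcal{I})}$. That is, $$\alpha(\mathcal{I})=\min\{y_1+\cdots+y_n\mid (y_1,\ldots,y_n)\in\overline{\mathcal{C}(\mathcal{I})}\},$$ where $\overline{\mathcal{C}(\mathcal{I})}$ is the closure in the Euclidean topology of $\mathbb{R}^n$ of the limiting body $\mathcal{C}(\mathcal{I})$ of the family.
   Context: A graded family of ideals is a collection $\{I_m\}_{m\ge1}$ with $I_aI_b\subseteq I_{a+b}$ for all $a,b$. For a nonzero homogeneous ideal $J$, $\alpha(J)$ is the least degree of a nonzero element of $J$. The asymptotic initial degree of the family is $\alpha(\mathcal{I})=\lim_{m\to\infty}\alpha(I_m)/m$ (this limit exists). For a monomial ideal $J$, the Newton polyhedron $NP(J)\subseteq\mathbb{R}^n$ is the convex hull of the exponent vectors $\mathbf{a}\in\mathbb{N}^n$ of all monomials $x_1^{a_1}\cdots x_n^{a_n}\in J$. The limiting body of the family is $\mathcal{C}(\mathcal{I})=\bigcup_{m\geq1}\frac1m NP(I_m)$. *)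

theory Defs
  imports "HOL-Analysis.Analysis" "HOL-Library.Poly_Mapping"
begin

text \<open>
  The polynomial ring \<open>K[x\<^sub>1,\<dots>,x\<^sub>n]\<close> is the type of finitely supported functions from
  exponent vectors to coefficients, with convolution product; the variables are indexed by the
  finite type \<open>'n\<close>, so that \<open>n = CARD('n)\<close>.
\<close>

type_synonym ('n, 'k) mpol = "('n \<Rightarrow>\<^sub>0 nat) \<Rightarrow>\<^sub>0 'k"

text \<open>
  The ideals of a commutative ring are its submodules as a module over itself: the predicate
  \<open>ring_ideal.subspace\<close> says that a set is an ideal, and \<open>ring_ideal.span S\<close> is the ideal
  generated by \<open>S\<close>.
\<close>

global_interpretation ring_ideal: module "(*) :: 'a::comm_ring_1 \<Rightarrow> 'a \<Rightarrow> 'a"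
  by standard (simp_all add: algebra_simps)

definition ideal_mult :: "'a::comm_ring_1 set \<Rightarrow> 'a set \<Rightarrow> 'a set" where
  "ideal_mult I J = ring_ideal.span {f * g | f g. f \<in> I \<and> g \<in> J}"

definition monomial :: "('n \<Rightarrow>\<^sub>0 nat) \<Rightarrow> ('n, 'k::comm_ring_1) mpol" where
  "monomial a = Poly_Mapping.single a 1"

definition monomial_ideal :: "('n, 'k::comm_ring_1) mpol set \<Rightarrow> bool" where
  "monomial_ideal J \<longleftrightarrow> (\<exists>A. J = ring_ideal.span (monomial ` A))"

text \<open>Families are functions on \<open>nat\<close>; the value at \<open>0\<close> is never constrained or used.\<close>

definition graded_family :: "(nat \<Rightarrow> 'a::comm_ring_1 set) \<Rightarrow> bool" where
  "graded_family I \<longleftrightarrow>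
     (\<forall>m\<ge>1. ring_ideal.subspace (I m)) \<and>
     (\<forall>a\<ge>1. \<forall>b\<ge>1. ideal_mult (I a) (I b) \<subseteq> I (a + b))"

definition exponent_degree :: "('n::finite \<Rightarrow>\<^sub>0 nat) \<Rightarrow> nat" where
  "exponent_degree a = (\<Sum>i\<in>UNIV. Poly_Mapping.lookup a i)"

text \<open>The total degree; its value at the zero polynomial is a dummy value.\<close>

definition total_degree :: "('n::finite, 'k::zero) mpol \<Rightarrow> nat" where
  "total_degree f = (if f = 0 then 0 else Max (exponent_degree ` Poly_Mapping.keys f))"

definition initial_degree :: "('n::finite, 'k::zero) mpol set \<Rightarrow> nat" where
  "initial_degree J = (LEAST d. \<exists>f\<in>J. f \<noteq> 0 \<and> total_degree f = d)"

text \<open>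
  The limit exists for graded families of nonzero monomial ideals, see
  \<open>tendsto_asymptotic_initial_degree\<close> below.
\<close>

definition asymptotic_initial_degree :: "(nat \<Rightarrow> ('n::finite, 'k::zero) mpol set) \<Rightarrow> real" where
  "asymptotic_initial_degree I = lim (\<lambda>m. real (initial_degree (I m)) / real m)"

definition exponent_vector :: "('n::finite \<Rightarrow>\<^sub>0 nat) \<Rightarrow> real ^ 'n" where
  "exponent_vector a = (\<chi> i. real (Poly_Mapping.lookup a i))"

definition newton_polyhedron :: "('n::finite, 'k::comm_ring_1) mpol set \<Rightarrow> (real ^ 'n) set" where
  "newton_polyhedron J = convex hull (exponent_vector ` {a. monomial a \<in> J})"

definition limiting_body :: "(nat \<Rightarrow> ('n::finite, 'k::comm_ring_1) mpol set) \<Rightarrow> (real ^ 'n) set" where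
  "limiting_body I = (\<Union>m\<in>{1..}. (\<lambda>y. (1 / real m) *\<^sub>R y) ` newton_polyhedron (I m))"

subsection \<open>Existence of the asymptotic initial degree\<close>

lemma exponent_degree_add: "exponent_degree (a + b) = exponent_degree a + exponent_degree b"
  by (simp add: exponent_degree_def lookup_add sum.distrib)

lemma monomial_mult: "monomial a * monomial b = monomial (a + b)"
  by (simp add: monomial_def mult_single)

lemma monomial_neq_0: "(monomial a :: ('n, 'k::comm_ring_1) mpol) \<noteq> 0"
  by (metis lookup_single_eq lookup_zero monomial_def zero_neq_one)

lemma total_degree_monomial:
  "total_degree (monomial a :: ('n::finite, 'k::comm_ring_1) mpol) = exponent_degree a"
  by (simp add: total_degree_def monomial_neq_0) (simp add: monomial_def)

lemma monomial_ideal_contains_monomials: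
  fixes f :: "('n, 'k::comm_ring_1) mpol"
  assumes J: "monomial_ideal J" and f: "f \<in> J" and a: "a \<in> Poly_Mapping.keys f"
  shows "monomial a \<in> J"
proof -
  obtain A where A: "J = ring_ideal.span (monomial ` A)"
    using J by (auto simp: monomial_ideal_def)
  have "f \<in> ring_ideal.span (monomial ` A)" using f A by simp
  then have "\<forall>a\<in>Poly_Mapping.keys f. monomial a \<in> J"
  proof (induction rule: ring_ideal.span_induct_alt)
    case base
    then show ?case by simp
  next
    case (step c x y)
    then obtain b where b: "b \<in> A" "x = monomial b" by auto
    show ?case
    proof
      fix e assume "e \<in> Poly_Mapping.keys (c * x + y)"
      then consider "e \<in> Poly_Mapping.keys (c * x)" | "e \<in> Poly_Mapping.keys y"
        using keys_add[of "c * x" y] by blast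
      then show "monomial e \<in> J"
      proof cases
        case 1
        then obtain d where "e = d + b"
          using keys_mult[of c x] b by (auto simp: monomial_def split: if_splits)
        then have "(monomial e :: ('n, 'k) mpol) = monomial d * monomial b"
          by (simp add: monomial_mult)
        then show ?thesis
          using A b(1) by (simp add: ring_ideal.span_base ring_ideal.span_scale)
      qed (use step.IH in blast)
    qed
  qed
  then show ?thesis using a by blast
qed

lemma ex_monomial_initial_degree:
  fixes J :: "('n::finite, 'k::comm_ring_1) mpol set"
  assumes J: "monomial_ideal J" and nz: "J \<noteq> {0}"
  obtains a where "monomial a \<in> J" "exponent_degree a = initial_degree J"
proof -
  have "0 \<in> J" using J by (auto simp: monomial_ideal_def ring_ideal.span_zero)
  then obtain g where "g \<in> J" "g \<noteq> 0" using nz by blast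
  then have "\<exists>d. \<exists>f\<in>J. f \<noteq> 0 \<and> total_degree f = d" by blast
  then obtain f where f: "f \<in> J" "f \<noteq> 0" "total_degree f = initial_degree J"
    unfolding initial_degree_def using LeastI_ex[of "\<lambda>d. \<exists>f\<in>J. f \<noteq> 0 \<and> total_degree f = d"] by blast
  have "exponent_degree ` Poly_Mapping.keys f \<noteq> {}" using f(2) by simp
  then have "Max (exponent_degree ` Poly_Mapping.keys f) \<in> exponent_degree ` Poly_Mapping.keys f"
    by (intro Max_in) auto
  then obtain a where "a \<in> Poly_Mapping.keys f" "exponent_degree a = initial_degree J"
    using f(2,3) unfolding total_degree_def by (metis imageE)
  then show ?thesis using that monomial_ideal_contains_monomials[OF J f(1)] by blast
qed

lemma initial_degree_le:
  "f \<in> J \<Longrightarrow> f \<noteq> 0 \<Longrightarrow> initial_degree J \<le> total_degree f"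
  unfolding initial_degree_def by (rule Least_le) blast

lemma initial_degree_subadditive:
  fixes I :: "nat \<Rightarrow> ('n::finite, 'k::comm_ring_1) mpol set"
  assumes I: "graded_family I" "\<And>m. m \<ge> 1 \<Longrightarrow> monomial_ideal (I m)"
    "\<And>m. m \<ge> 1 \<Longrightarrow> I m \<noteq> {0}"
    and p: "p \<ge> 1" and q: "q \<ge> 1"
  shows "initial_degree (I (p + q)) \<le> initial_degree (I p) + initial_degree (I q)"
proof -
  obtain a where a: "monomial a \<in> I p" "exponent_degree a = initial_degree (I p)"
    using ex_monomial_initial_degree I p by metis
  obtain b where b: "monomial b \<in> I q" "exponent_degree b = initial_degree (I q)"
    using ex_monomial_initial_degree I q by metis
  have "monomial (a + b) \<in> ideal_mult (I p) (I q)"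
    unfolding ideal_mult_def using a b
    by (intro ring_ideal.span_base) (auto simp: monomial_mult[symmetric])
  then have "monomial (a + b) \<in> I (p + q)"
    using I(1) p q by (auto simp: graded_family_def)
  from initial_degree_le[OF this monomial_neq_0] show ?thesis
    by (simp add: total_degree_monomial exponent_degree_add a b)
qed

text \<open>Fekete's lemma for nonnegative sequences.\<close>

lemma fekete:
  fixes a :: "nat \<Rightarrow> real"
  assumes nonneg: "\<And>n. a n \<ge> 0"
    and sub: "\<And>p q. p \<ge> 1 \<Longrightarrow> q \<ge> 1 \<Longrightarrow> a (p + q) \<le> a p + a q"
  shows "(\<lambda>n. a n / real n) \<longlonglongrightarrow> (INF n\<in>{1..}. a n / real n)"
proof (rule LIMSEQ_I)
  fix e :: real assume e: "e > 0"
  define L where "L = (INF n\<in>{1..}. a n / real n)"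
  have bdd: "bdd_below ((\<lambda>n. a n / real n) ` {1..})"
    by (rule bdd_belowI[of _ 0]) (auto simp: nonneg)
  have lower: "L \<le> a n / real n" if "n \<ge> 1" for n
    unfolding L_def using that by (intro cINF_lower[OF bdd]) auto
  have "\<exists>k\<in>{1..}. a k / real k < L + e / 2"
    using cINF_less_iff[OF _ bdd, of "L + e / 2"] e by (auto simp: L_def)
  then obtain k where k: "k \<ge> 1" "a k / real k < L + e / 2" by auto
  define M where "M = (\<Sum>i<2 * k. a i)"
  have small: "a n \<le> M" if "n < 2 * k" for n
    unfolding M_def using that nonneg by (intro member_le_sum) auto
  have bound: "a n \<le> real n * (a k / real k) + M" if "n \<ge> k" for n
    using that
  proof (induction n rule: less_induct)
    case (less n)
    show ?case
    proof (cases "n < 2 * k")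
      case True
      then show ?thesis using small[OF True] nonneg[of k] by (simp add: add_increasing)
    next
      case False
      have "a n \<le> a (n - k) + a k" using sub[of "n - k" k] False k by simp
      also have "a (n - k) \<le> real (n - k) * (a k / real k) + M"
        using False k by (intro less.IH) auto
      also have "real (n - k) * (a k / real k) + M + a k = real n * (a k / real k) + M"
      proof -
        have "real n = real (n - k) + real k" using False by linarith
        moreover have "real k * (a k / real k) = a k" using k by simp
        ultimately show ?thesis by (simp only: distrib_right)
      qed
      finally show ?thesis by simp
    qed
  qed
  obtain N where N: "real N > 2 * M / e" using reals_Archimedean2 by blast
  show "\<exists>n0. \<forall>n\<ge>n0. norm (a n / real n - (INF n\<in>{1..}. a n / real n)) < e"
  proof (intro exI allI impI)
    fix n assume n: "n \<ge> max N k"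
    then have n1: "n \<ge> 1" "real n > 0" using k by auto
    have "real n > 2 * M / e" using n N by linarith
    then have "M / real n < e / 2" using e n1 by (simp add: field_simps)
    moreover have "a n / real n \<le> a k / real k + M / real n"
    proof -
      have "a n / real n \<le> (real n * (a k / real k) + M) / real n"
        using bound[of n] n by (intro divide_right_mono) auto
      also have "\<dots> = a k / real k + M / real n" using n1 by (simp add: add_divide_distrib)
      finally show ?thesis .
    qed
    ultimately have "a n / real n < L + e" using k(2) by linarith
    with lower[OF n1(1)] show "norm (a n / real n - (INF n\<in>{1..}. a n / real n)) < e"
      unfolding L_def[symmetric] by simp
  qed
qed

lemma tendsto_asymptotic_initial_degree:
  fixes I :: "nat \<Rightarrow> ('n::finite, 'k::comm_ring_1) mpol set"
  assumes "graded_family I" "\<And>m. m \<ge> 1 \<Longrightarrow> monomial_ideal (I m)"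
    "\<And>m. m \<ge> 1 \<Longrightarrow> I m \<noteq> {0}"
  shows "(\<lambda>m. real (initial_degree (I m)) / real m) \<longlonglongrightarrow> asymptotic_initial_degree I"
proof -
  have "convergent (\<lambda>m. real (initial_degree (I m)) / real m)"
    unfolding convergent_def
    by (rule exI, rule fekete)
      (use initial_degree_subadditive[OF assms] in \<open>auto simp flip: of_nat_add\<close>)
  then show ?thesis
    by (simp add: asymptotic_initial_degree_def convergent_LIMSEQ_iff)
qed

end

theory Submission
  imports Defs
begin

text \<open>
  Points of \<open>(1/m) NP(I\<^sub>m)\<close> have coordinate sum at least \<open>\<alpha>(I\<^sub>m)/m\<close>, and by Fekete's lemma the
  asymptotic initial degree is the infimum of these quotients; this bounds the coordinate sum from
  below on the limiting body, hence on its closure. Conversely, the rescaled exponent vectors of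
  monomials of least degree in \<open>I\<^sub>m\<close> form a bounded sequence, and any of its limit points attains
  the bound.
\<close>

text \<open>By \<open>fekete\<close> and uniqueness of limits the asymptotic initial degree is an
  infimum over m \<ge> 1, so it lies below each term. The reals are only conditionally complete,
  hence the explicit lower bound 0.\<close>

lemma asymptotic_initial_degree_le:
  fixes I :: "nat \<Rightarrow> ('n::finite, 'k::comm_ring_1) mpol set"
  assumes I: "graded_family I" "\<And>m. m \<ge> 1 \<Longrightarrow> monomial_ideal (I m)"
    "\<And>m. m \<ge> 1 \<Longrightarrow> I m \<noteq> {0}"
    and m: "m \<ge> 1"
  shows "asymptotic_initial_degree I \<le> real (initial_degree (I m)) / real m"
proof -
  have "(\<lambda>m. real (initial_degree (I m)) / real m)
      \<longlonglongrightarrow> (INF m\<in>{1..}. real (initial_degree (I m)) / real m)"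
    by (rule fekete) (use initial_degree_subadditive[OF I] in \<open>auto simp flip: of_nat_add\<close>)
  then have "asymptotic_initial_degree I = (INF m\<in>{1..}. real (initial_degree (I m)) / real m)"
    using tendsto_asymptotic_initial_degree[OF I] LIMSEQ_unique by blast
  also have "\<dots> \<le> real (initial_degree (I m)) / real m"
    using m by (intro cINF_lower bdd_belowI[of _ 0]) auto
  finally show ?thesis .
qed

lemma sum_exponent_vector: "(\<Sum>i\<in>UNIV. exponent_vector a $ i) = real (exponent_degree a)"
  by (simp add: exponent_vector_def exponent_degree_def)

text \<open>The coordinate sum is linear, so the bound cuts out a half-space, and it suffices to
  check it on the exponent vectors that span the hull.\<close>

lemma initial_degree_le_newton_polyhedron:
  fixes J :: "('n::finite, 'k::comm_ring_1) mpol set"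
  assumes y: "y \<in> newton_polyhedron J"
  shows "real (initial_degree J) \<le> (\<Sum>i\<in>UNIV. y $ i)"
proof -
  let ?H = "{y :: real ^ 'n. real (initial_degree J) \<le> (\<Sum>i\<in>UNIV. y $ i)}"
  \<comment> \<open>The coordinate sum is the inner product with the all-ones vector, the form that
    \<open>convex_halfspace_ge\<close> expects.\<close>
  have "?H = {y. (\<chi> i. 1) \<bullet> y \<ge> real (initial_degree J)}"
    by (simp add: inner_vec_def)
  then have "convex ?H"
    by (simp only: convex_halfspace_ge)
  \<comment> \<open>Exponents do not determine a coefficient ring, so \<open>'k\<close> is fixed by
    hand when a degree is rewritten as a total degree.\<close>
  moreover have "exponent_vector ` {a. monomial a \<in> J} \<subseteq> ?H"
    using initial_degree_le[OF _ monomial_neq_0]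
    by (auto simp: sum_exponent_vector total_degree_monomial[where 'k='k, symmetric])
  ultimately have "newton_polyhedron J \<subseteq> ?H"
    unfolding newton_polyhedron_def by (rule hull_minimal[rotated])
  with y show ?thesis by blast
qed

text \<open>Every rescaled polyhedron lies in one half-space independent of m; this half-space is
  closed, so it also contains the closure of their union.\<close>

lemma asymptotic_initial_degree_le_closure:
  fixes I :: "nat \<Rightarrow> ('n::finite, 'k::comm_ring_1) mpol set"
  assumes I: "graded_family I" "\<And>m. m \<ge> 1 \<Longrightarrow> monomial_ideal (I m)"
    "\<And>m. m \<ge> 1 \<Longrightarrow> I m \<noteq> {0}"
    and y: "y \<in> closure (limiting_body I)"
  shows "asymptotic_initial_degree I \<le> (\<Sum>i\<in>UNIV. y $ i)"
proof -
  let ?H = "{y :: real ^ 'n. asymptotic_initial_degree I \<le> (\<Sum>i\<in>UNIV. y $ i)}"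
  have "limiting_body I \<subseteq> ?H"
  proof
    fix z assume "z \<in> limiting_body I"
    then obtain m w where m: "m \<ge> 1" and w: "w \<in> newton_polyhedron (I m)"
      and z: "z = (1 / real m) *\<^sub>R w"
      by (auto simp: limiting_body_def)
    have "asymptotic_initial_degree I \<le> real (initial_degree (I m)) / real m"
      by (rule asymptotic_initial_degree_le[OF I m])
    also have "\<dots> \<le> (\<Sum>i\<in>UNIV. w $ i) / real m"
      by (intro divide_right_mono initial_degree_le_newton_polyhedron w) simp
    also have "\<dots> = (\<Sum>i\<in>UNIV. z $ i)"
      by (simp add: z sum_divide_distrib)
    finally show "z \<in> ?H" by simp
  qed
  moreover have "closed ?H"
    by (intro closed_Collect_le continuous_intros)
  ultimately have "closure (limiting_body I) \<subseteq> ?H"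
    by (rule closure_minimal)
  with y show ?thesis by blast
qed

text \<open>The limiting body itself may miss the minimum: for the ideals generated by
  \<open>x^(m+1)\<close> in one variable it is the open ray above 1. The minimizer is therefore
  built by compactness.\<close>

lemma ex_closure_limiting_body_sum_eq:
  fixes I :: "nat \<Rightarrow> ('n::finite, 'k::comm_ring_1) mpol set"
  assumes I: "graded_family I" "\<And>m. m \<ge> 1 \<Longrightarrow> monomial_ideal (I m)"
    "\<And>m. m \<ge> 1 \<Longrightarrow> I m \<noteq> {0}"
  obtains y where "y \<in> closure (limiting_body I)"
    "(\<Sum>i\<in>UNIV. y $ i) = asymptotic_initial_degree I"
proof -
  have "\<exists>a. monomial a \<in> I m \<and> exponent_degree a = initial_degree (I m)" if "m \<ge> 1" for m
    using ex_monomial_initial_degree I(2,3) that by metis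
  then obtain a where a: "\<And>m. m \<ge> 1 \<Longrightarrow> monomial (a m) \<in> I m"
    "\<And>m. m \<ge> 1 \<Longrightarrow> exponent_degree (a m) = initial_degree (I m)"
    by metis
  \<comment> \<open>The shift by \<open>Suc\<close> skips index 0, where the family is unconstrained
    and the quotient would divide by zero.\<close>
  define d where "d m = real (initial_degree (I (Suc m))) / real (Suc m)" for m
  define u where "u m = (1 / real (Suc m)) *\<^sub>R exponent_vector (a (Suc m))" for m
  have sum_u: "(\<Sum>i\<in>UNIV. u m $ i) = d m" for m
    by (simp add: u_def d_def sum_exponent_vector a(2) flip: sum_divide_distrib)
  have u_in: "u m \<in> limiting_body I" for m
    unfolding limiting_body_def newton_polyhedron_def u_def
    by (intro UN_I[of "Suc m"] imageI hull_inc) (auto intro: a(1))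
  have d_lim: "d \<longlonglongrightarrow> asymptotic_initial_degree I"
    unfolding d_def by (rule LIMSEQ_Suc[OF tendsto_asymptotic_initial_degree[OF I]])
  then obtain B where B: "\<And>m. norm (d m) \<le> B"
    by (metis BseqE convergentI convergent_imp_Bseq)
  \<comment> \<open>The coordinates of \<open>u m\<close> are nonnegative, so its l1 norm is its
    coordinate sum \<open>d m\<close>, which is bounded because \<open>d\<close> converges.\<close>
  have "norm (u m) \<le> B" for m
  proof -
    have "norm (u m) \<le> (\<Sum>i\<in>UNIV. \<bar>u m $ i\<bar>)" by (rule norm_le_l1_cart)
    also have "\<dots> = d m"
      unfolding sum_u[symmetric] by (intro sum.cong) (simp_all add: u_def exponent_vector_def)
    also have "\<dots> \<le> B" using B[of m] by simp
    finally show ?thesis .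
  qed
  then have "bounded (range u)" by (auto simp: bounded_iff)
  then obtain y r where r: "strict_mono r" and lim: "(u \<circ> r) \<longlonglongrightarrow> y"
    using bounded_imp_convergent_subsequence by blast
  show thesis
  proof
    show "y \<in> closure (limiting_body I)"
      using lim u_in unfolding closure_sequential by (auto intro!: exI[of _ "u \<circ> r"])
    have "(\<lambda>m. \<Sum>i\<in>UNIV. (u \<circ> r) m $ i) \<longlonglongrightarrow> (\<Sum>i\<in>UNIV. y $ i)"
      by (intro tendsto_sum tendsto_vec_nth lim)
    \<comment> \<open>These coordinate sums are a subsequence of \<open>d\<close>, so they inherit
      its limit.\<close>
    moreover have "(\<lambda>m. \<Sum>i\<in>UNIV. (u \<circ> r) m $ i) \<longlonglongrightarrow> asymptotic_initial_degree I"
      using LIMSEQ_subseq_LIMSEQ[OF d_lim r] by (simp add: sum_u o_def)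
    ultimately show "(\<Sum>i\<in>UNIV. y $ i) = asymptotic_initial_degree I"
      by (rule LIMSEQ_unique)
  qed
qed

theorem theorem4p5:
  fixes I :: "nat \<Rightarrow> ('n::finite, 'k::field) mpol set"
  assumes "graded_family I"
    and "\<And>m. m \<ge> 1 \<Longrightarrow> monomial_ideal (I m)"
    and "\<And>m. m \<ge> 1 \<Longrightarrow> I m \<noteq> {0}"
  shows "\<exists>y. is_arg_min (\<lambda>y. \<Sum>i\<in>UNIV. y $ i) (\<lambda>y. y \<in> closure (limiting_body I)) y \<and>
    asymptotic_initial_degree I = (\<Sum>i\<in>UNIV. y $ i)"
proof -
  obtain y where "y \<in> closure (limiting_body I)"
    "(\<Sum>i\<in>UNIV. y $ i) = asymptotic_initial_degree I"
    using ex_closure_limiting_body_sum_eq[OF assms] .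
  then show ?thesis
    using asymptotic_initial_degree_le_closure[OF assms]
    by (intro exI[of _ y]) (auto simp: is_arg_min_linorder)
qed

end
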